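(* The solution $f(t,y)$ of the Cauchy problem $$\begin{cases}f_t(t,y)+\frac12 f_{yy}(t,y)\frac{\gamma^2(t)}{\sigma^2}+f_y(t,y)\frac{\gamma(t)(r-y)}{\sigma^2}\\ \quad-\Big[\frac{(r-y+a\sqrt{\gamma(t)})^2}{2\sigma^2}I_{\{r-y+a\sqrt{\gamma(t)}\le0\}}+\frac{(r-y-a\sqrt{\gamma(t)})^2}{2\sigma^2}I_{\{r-y-a\sqrt{\gamma(t)}\ge0\}}\Big]=0,&(t,y)\in[0,T)\times\mathbb{R},\\ f(T,y)=0,&y\in\mathbb{R},\end{cases}$$ satisfies $f(t,y)<0$ for all $t\in[0,T)$ and $y\in\mathbb{R}$. Besides, for each $t\in[0,T)$, $f_y(t,y)$ is monotonically decreasing in $y\in\mathbb{R}$, and $$f_y(t,y)\begin{cases}>0,& y<r,\ t\in[0,T),\\ =0,& y=r,\ t\in[0,T],\ \text{ or }\ y\in\mathbb{R},\ t=T,\\ <0,& y>r,\ t\in[0,T).\end{cases}$$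
   Context: Constants: $T>0$, $\sigma>0$, $\sigma_0>0$, $a\ge0$, $r\in\mathbb{R}$. $\gamma(t)=(\sigma_0^{-2}+t\sigma^{-2})^{-1}$ for $t\in[0,T]$. "The solution" is the unique solution of class $C^{1,2}([0,T)\times\mathbb{R})\cap C([0,T]\times\mathbb{R})$ satisfying $\max_{0\le t\le T}|f(t,y)|\le C_1(1+y^2)$ for all $y\in\mathbb{R}$ and some constant $C_1>0$. Subscripts denote partial derivatives and $I_{\{\cdot\}}$ is the indicator. *)

theory Defs
  imports "HOL-Analysis.Analysis"
begin

definition gam :: "real \<Rightarrow> real \<Rightarrow> real \<Rightarrow> real" where
  "gam \<sigma> \<sigma>0 t = inverse (inverse (\<sigma>0\<^sup>2) + t * inverse (\<sigma>\<^sup>2))"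

text \<open>Functions of \<open>(t, y)\<close> are curried and total; only their values on \<open>{0..T} \<times> UNIV\<close> matter.
  The time derivative is taken within \<open>{0..<T}\<close>, so it is one-sided at \<open>t = 0\<close> and
  two-sided for \<open>0 < t < T\<close>.\<close>

definition D_t :: "real \<Rightarrow> (real \<Rightarrow> real \<Rightarrow> real) \<Rightarrow> real \<Rightarrow> real \<Rightarrow> real" where
  "D_t T f t y = vector_derivative (\<lambda>s. f s y) (at t within {0..<T})"

definition D_y :: "(real \<Rightarrow> real \<Rightarrow> real) \<Rightarrow> real \<Rightarrow> real \<Rightarrow> real" where
  "D_y f t y = deriv (\<lambda>x. f t x) y"

definition D_yy :: "(real \<Rightarrow> real \<Rightarrow> real) \<Rightarrow> real \<Rightarrow> real \<Rightarrow> real" where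
  "D_yy f t y = deriv (\<lambda>x. D_y f t x) y"

definition C12 :: "real \<Rightarrow> (real \<Rightarrow> real \<Rightarrow> real) \<Rightarrow> bool" where
  "C12 T f \<longleftrightarrow>
     (\<forall>t\<in>{0..<T}. \<forall>y.
        (\<lambda>s. f s y) differentiable (at t within {0..<T}) \<and>
        (\<lambda>x. f t x) differentiable (at y) \<and>
        (\<lambda>x. D_y f t x) differentiable (at y)) \<and>
     continuous_on ({0..<T} \<times> UNIV) (\<lambda>(t, y). f t y) \<and>
     continuous_on ({0..<T} \<times> UNIV) (\<lambda>(t, y). D_t T f t y) \<and>
     continuous_on ({0..<T} \<times> UNIV) (\<lambda>(t, y). D_y f t y) \<and>
     continuous_on ({0..<T} \<times> UNIV) (\<lambda>(t, y). D_yy f t y)"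

definition quadratic_growth :: "real \<Rightarrow> (real \<Rightarrow> real \<Rightarrow> real) \<Rightarrow> bool" where
  "quadratic_growth T f \<longleftrightarrow>
     (\<exists>C>0. \<forall>y. \<forall>t\<in>{0..T}. \<bar>f t y\<bar> \<le> C * (1 + y\<^sup>2))"

definition cauchy_problem ::
  "real \<Rightarrow> real \<Rightarrow> real \<Rightarrow> real \<Rightarrow> real \<Rightarrow> (real \<Rightarrow> real \<Rightarrow> real) \<Rightarrow> bool" where
  "cauchy_problem T \<sigma> \<sigma>0 a r f \<longleftrightarrow>
     (\<forall>t\<in>{0..<T}. \<forall>y.
        D_t T f t y
        + 1 / 2 * D_yy f t y * ((gam \<sigma> \<sigma>0 t)\<^sup>2 / \<sigma>\<^sup>2)
        + D_y f t y * (gam \<sigma> \<sigma>0 t * (r - y) / \<sigma>\<^sup>2)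
        - ((r - y + a * sqrt (gam \<sigma> \<sigma>0 t))\<^sup>2 / (2 * \<sigma>\<^sup>2)
             * of_bool (r - y + a * sqrt (gam \<sigma> \<sigma>0 t) \<le> 0)
           + (r - y - a * sqrt (gam \<sigma> \<sigma>0 t))\<^sup>2 / (2 * \<sigma>\<^sup>2)
             * of_bool (r - y - a * sqrt (gam \<sigma> \<sigma>0 t) \<ge> 0)) = 0) \<and>
     (\<forall>y. f T y = 0)"

definition is_solution ::
  "real \<Rightarrow> real \<Rightarrow> real \<Rightarrow> real \<Rightarrow> real \<Rightarrow> (real \<Rightarrow> real \<Rightarrow> real) \<Rightarrow> bool" where
  "is_solution T \<sigma> \<sigma>0 a r f \<longleftrightarrow>
     C12 T f \<and>
     continuous_on ({0..T} \<times> UNIV) (\<lambda>(t, y). f t y) \<and>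
     quadratic_growth T f \<and>
     cauchy_problem T \<sigma> \<sigma>0 a r f"

end

theory Submission
  imports Defs
begin

text \<open>
  Since \<open>\<gamma>' = - \<gamma>\<^sup>2 / \<sigma>\<^sup>2\<close>, the substitution \<open>g t x = f t (r + \<gamma> t * x)\<close> removes the drift:
  \<open>g\<close> solves the backward heat equation \<open>g\<^sub>t + \<kappa> g\<^sub>x\<^sub>x = q\<close> with \<open>\<kappa> = 1 / (2 \<sigma>\<^sup>2)\<close> and a source \<open>q\<close> that
  is nonnegative, even and convex in \<open>x\<close>, and strictly increasing in \<open>\<bar>x\<bar>\<close> for large \<open>\<bar>x\<bar>\<close>.
  Differences of translates and reflections of \<open>g\<close> solve the same equation, so the maximum
  principle gives everything without differentiating the equation: \<open>g t x - g t (- x)\<close> yields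
  evenness, second differences yield concavity, and \<open>g t x - g t (2 b - x)\<close> on \<open>x > b > 0\<close>
  yields that \<open>g\<close> decreases in \<open>\<bar>x\<bar>\<close>. Strict inequalities hold where the source is positive, by
  the first and second order conditions at a maximum, and spread from there to smaller \<open>x\<close> by
  comparison with \<open>exp (c\<^sup>2 \<kappa> (t1 - t)) sinh (c (x - b))\<close> for large \<open>c\<close>.
\<close>

subsection \<open>Maximum principles for the backward heat equation\<close>

text \<open>The equation \<open>u_t + \<kappa> u_xx = q\<close> for a problem with data at the final
  time, so \<open>q \<ge> 0\<close> makes \<open>u\<close> a subsolution. Pointwise derivatives are
  what the conditions at a maximum consume. The time derivative is one-sided at \<open>s\<close>,
  which lets a maximum at the initial time be treated like any other.\<close>

definition has_heat_source ::
  "real \<Rightarrow> real \<Rightarrow> real \<Rightarrow> real set \<Rightarrow> (real \<Rightarrow> real \<Rightarrow> real) \<Rightarrow> (real \<Rightarrow> real \<Rightarrow> real) \<Rightarrow> bool" where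
  "has_heat_source \<kappa> s T X u q \<longleftrightarrow>
     (\<exists>ut ux uxx. \<forall>t\<in>{s..<T}. \<forall>x\<in>X.
        ((\<lambda>\<tau>. u \<tau> x) has_real_derivative ut t x) (at t within {s..<T}) \<and>
        ((\<lambda>z. u t z) has_real_derivative ux t x) (at x) \<and>
        ((\<lambda>z. ux t z) has_real_derivative uxx t x) (at x) \<and>
        ut t x + \<kappa> * uxx t x = q t x)"

lemma has_heat_sourceI:
  assumes "\<And>t x. t \<in> {s..<T} \<Longrightarrow> x \<in> X \<Longrightarrow>
      ((\<lambda>\<tau>. u \<tau> x) has_real_derivative ut t x) (at t within {s..<T})"
    and "\<And>t x. t \<in> {s..<T} \<Longrightarrow> x \<in> X \<Longrightarrow> ((\<lambda>z. u t z) has_real_derivative ux t x) (at x)"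
    and "\<And>t x. t \<in> {s..<T} \<Longrightarrow> x \<in> X \<Longrightarrow> ((\<lambda>z. ux t z) has_real_derivative uxx t x) (at x)"
    and "\<And>t x. t \<in> {s..<T} \<Longrightarrow> x \<in> X \<Longrightarrow> ut t x + \<kappa> * uxx t x = q t x"
  shows "has_heat_source \<kappa> s T X u q"
  unfolding has_heat_source_def using assms by blast

lemma has_heat_sourceE:
  assumes "has_heat_source \<kappa> s T X u q"
  obtains ut ux uxx where
    "\<And>t x. t \<in> {s..<T} \<Longrightarrow> x \<in> X \<Longrightarrow>
      ((\<lambda>\<tau>. u \<tau> x) has_real_derivative ut t x) (at t within {s..<T})"
    "\<And>t x. t \<in> {s..<T} \<Longrightarrow> x \<in> X \<Longrightarrow> ((\<lambda>z. u t z) has_real_derivative ux t x) (at x)"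
    "\<And>t x. t \<in> {s..<T} \<Longrightarrow> x \<in> X \<Longrightarrow> ((\<lambda>z. ux t z) has_real_derivative uxx t x) (at x)"
    "\<And>t x. t \<in> {s..<T} \<Longrightarrow> x \<in> X \<Longrightarrow> ut t x + \<kappa> * uxx t x = q t x"
  using assms unfolding has_heat_source_def by blast

section \<open>Stability of the equation under restriction, linear combination and
  isometries\<close>

lemma has_heat_source_subset:
  assumes "has_heat_source \<kappa> s T X u q" "s \<le> s'" "T' \<le> T" "Y \<subseteq> X"
  shows "has_heat_source \<kappa> s' T' Y u q"
proof -
  obtain ut ux uxx where *:
    "\<And>t x. t \<in> {s..<T} \<Longrightarrow> x \<in> X \<Longrightarrow>
      ((\<lambda>\<tau>. u \<tau> x) has_real_derivative ut t x) (at t within {s..<T})"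
    "\<And>t x. t \<in> {s..<T} \<Longrightarrow> x \<in> X \<Longrightarrow> ((\<lambda>z. u t z) has_real_derivative ux t x) (at x)"
    "\<And>t x. t \<in> {s..<T} \<Longrightarrow> x \<in> X \<Longrightarrow> ((\<lambda>z. ux t z) has_real_derivative uxx t x) (at x)"
    "\<And>t x. t \<in> {s..<T} \<Longrightarrow> x \<in> X \<Longrightarrow> ut t x + \<kappa> * uxx t x = q t x"
    using assms(1) by (rule has_heat_sourceE) blast
  have sub: "{s'..<T'} \<subseteq> {s..<T}" using assms by auto
  show ?thesis
  proof (rule has_heat_sourceI)
    fix t x assume "t \<in> {s'..<T'}" "x \<in> Y"
    with sub assms(4) have tx: "t \<in> {s..<T}" "x \<in> X" by auto
    show "((\<lambda>\<tau>. u \<tau> x) has_real_derivative ut t x) (at t within {s'..<T'})"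
      by (rule has_field_derivative_subset[OF *(1)[OF tx] sub])
    show "((\<lambda>z. u t z) has_real_derivative ux t x) (at x)" by (rule *(2)[OF tx])
    show "((\<lambda>z. ux t z) has_real_derivative uxx t x) (at x)" by (rule *(3)[OF tx])
    show "ut t x + \<kappa> * uxx t x = q t x" by (rule *(4)[OF tx])
  qed
qed

lemma has_heat_source_lincomb:
  assumes "has_heat_source \<kappa> s T X u p" "has_heat_source \<kappa> s T X v q"
  shows "has_heat_source \<kappa> s T X (\<lambda>t x. u t x + c * v t x) (\<lambda>t x. p t x + c * q t x)"
proof -
  obtain ut ux uxx where u:
    "\<And>t x. t \<in> {s..<T} \<Longrightarrow> x \<in> X \<Longrightarrow>
      ((\<lambda>\<tau>. u \<tau> x) has_real_derivative ut t x) (at t within {s..<T})"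
    "\<And>t x. t \<in> {s..<T} \<Longrightarrow> x \<in> X \<Longrightarrow> ((\<lambda>z. u t z) has_real_derivative ux t x) (at x)"
    "\<And>t x. t \<in> {s..<T} \<Longrightarrow> x \<in> X \<Longrightarrow> ((\<lambda>z. ux t z) has_real_derivative uxx t x) (at x)"
    "\<And>t x. t \<in> {s..<T} \<Longrightarrow> x \<in> X \<Longrightarrow> ut t x + \<kappa> * uxx t x = p t x"
    using assms(1) by (rule has_heat_sourceE) blast
  obtain vt vx vxx where v:
    "\<And>t x. t \<in> {s..<T} \<Longrightarrow> x \<in> X \<Longrightarrow>
      ((\<lambda>\<tau>. v \<tau> x) has_real_derivative vt t x) (at t within {s..<T})"
    "\<And>t x. t \<in> {s..<T} \<Longrightarrow> x \<in> X \<Longrightarrow> ((\<lambda>z. v t z) has_real_derivative vx t x) (at x)"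
    "\<And>t x. t \<in> {s..<T} \<Longrightarrow> x \<in> X \<Longrightarrow> ((\<lambda>z. vx t z) has_real_derivative vxx t x) (at x)"
    "\<And>t x. t \<in> {s..<T} \<Longrightarrow> x \<in> X \<Longrightarrow> vt t x + \<kappa> * vxx t x = q t x"
    using assms(2) by (rule has_heat_sourceE) blast
  show ?thesis
  proof (rule has_heat_sourceI)
    fix t x assume tx: "t \<in> {s..<T}" "x \<in> X"
    show "((\<lambda>\<tau>. u \<tau> x + c * v \<tau> x) has_real_derivative ut t x + c * vt t x) (at t within {s..<T})"
      by (intro DERIV_add DERIV_cmult u v tx)
    show "((\<lambda>z. u t z + c * v t z) has_real_derivative ux t x + c * vx t x) (at x)"
      by (intro DERIV_add DERIV_cmult u v tx)
    show "((\<lambda>z. ux t z + c * vx t z) has_real_derivative uxx t x + c * vxx t x) (at x)"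
      by (intro DERIV_add DERIV_cmult u v tx)
    show "ut t x + c * vt t x + \<kappa> * (uxx t x + c * vxx t x) = p t x + c * q t x"
      unfolding u(4)[OF tx, symmetric] v(4)[OF tx, symmetric] by (simp add: algebra_simps)
  qed
qed

lemma has_heat_source_diff:
  assumes "has_heat_source \<kappa> s T X u p" "has_heat_source \<kappa> s T X v q"
  shows "has_heat_source \<kappa> s T X (\<lambda>t x. u t x - v t x) (\<lambda>t x. p t x - q t x)"
  using has_heat_source_lincomb[OF assms, of "- 1"] by simp

text \<open>The second derivative picks up the factor \<open>m^2 = 1\<close>. Translations
  (\<open>m = 1\<close>) and reflections (\<open>m = -1\<close>) are thus covered at once.\<close>

lemma has_heat_source_isometry:
  assumes "has_heat_source \<kappa> s T UNIV u q" "m\<^sup>2 = 1"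
  shows "has_heat_source \<kappa> s T UNIV (\<lambda>t x. u t (c + m * x)) (\<lambda>t x. q t (c + m * x))"
proof -
  obtain ut ux uxx where u:
    "\<And>t x. t \<in> {s..<T} \<Longrightarrow>
      ((\<lambda>\<tau>. u \<tau> x) has_real_derivative ut t x) (at t within {s..<T})"
    "\<And>t x. t \<in> {s..<T} \<Longrightarrow> ((\<lambda>z. u t z) has_real_derivative ux t x) (at x)"
    "\<And>t x. t \<in> {s..<T} \<Longrightarrow> ((\<lambda>z. ux t z) has_real_derivative uxx t x) (at x)"
    "\<And>t x. t \<in> {s..<T} \<Longrightarrow> ut t x + \<kappa> * uxx t x = q t x"
    using assms(1) by (rule has_heat_sourceE) blast
  show ?thesis
  proof (rule has_heat_sourceI)
    fix t x assume t: "t \<in> {s..<T}"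
    have aff: "((\<lambda>x. c + m * x) has_real_derivative m) (at x)"
      by (auto intro!: derivative_eq_intros)
    show "((\<lambda>\<tau>. u \<tau> (c + m * x)) has_real_derivative ut t (c + m * x)) (at t within {s..<T})"
      by (rule u(1)[OF t])
    show "((\<lambda>z. u t (c + m * z)) has_real_derivative ux t (c + m * x) * m) (at x)"
      by (rule DERIV_chain2[OF u(2)[OF t] aff])
    show "((\<lambda>z. ux t (c + m * z) * m) has_real_derivative uxx t (c + m * x)) (at x)"
      using DERIV_cmult_right[OF DERIV_chain2[OF u(3)[OF t] aff], of m] assms(2)
      by (simp add: power2_eq_square mult.assoc)
    show "ut t (c + m * x) + \<kappa> * uxx t (c + m * x) = q t (c + m * x)"
      by (rule u(4)[OF t])
  qed
qed

section \<open>Conditions at a maximum and the weak maximum principle\<close>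

text \<open>If \<open>l > 0\<close>, then \<open>f' x = 0\<close> forces \<open>f' > 0\<close> just
  to the right of \<open>x\<close>, and the mean value theorem makes \<open>f\<close> exceed its
  maximum there.\<close>

lemma second_derivative_at_max_nonpos:
  fixes f f' :: "real \<Rightarrow> real"
  assumes "open X" "x \<in> X" and max: "\<And>z. z \<in> X \<Longrightarrow> f z \<le> f x"
    and f: "\<And>z. z \<in> X \<Longrightarrow> (f has_real_derivative f' z) (at z)"
    and f': "(f' has_real_derivative l) (at x)"
  shows "l \<le> 0"
proof (rule ccontr)
  assume "\<not> l \<le> 0"
  then have l: "0 < l" by simp
  obtain e where e: "e > 0" "\<And>z. dist z x < e \<Longrightarrow> z \<in> X"
    using assms(1,2) unfolding open_dist by blast
  have "f' x = 0"
    by (rule DERIV_local_max[OF f[OF assms(2)] e(1)]) (auto intro!: max e simp: dist_real_def abs_minus_commute)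
  obtain d where d: "d > 0" "\<And>h. h > 0 \<Longrightarrow> h < d \<Longrightarrow> f' x < f' (x + h)"
    using DERIV_pos_inc_right[OF f' l] by blast
  define h where "h = min d e / 2"
  have h: "h > 0" "h < d" "h < e" using d e by (auto simp: h_def)
  have "\<exists>z. z > x \<and> z < x + h \<and> f (x + h) - f x = (x + h - x) * f' z"
    by (rule MVT2) (use h in \<open>auto intro!: f e simp: dist_real_def\<close>)
  then obtain z where z: "z > x" "z < x + h" "f (x + h) - f x = h * f' z" by auto
  have "f' z > 0" using d(2)[of "z - x"] z h \<open>f' x = 0\<close> by auto
  then have "f (x + h) > f x" using z h by (smt (verit) mult_pos_pos)
  moreover have "x + h \<in> X" using h by (auto intro!: e simp: dist_real_def)
  ultimately show False using max by fastforce
qed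

text \<open>Both terms of \<open>q = u_t + \<kappa> u_xx\<close> are nonpositive at such a point.
  For \<open>u_t\<close> it suffices to look at later times, which exist because
  \<open>t < T\<close>.\<close>

lemma heat_source_at_max_nonpos:
  assumes "has_heat_source \<kappa> s T X u q" "\<kappa> \<ge> 0" "open X" "t \<in> {s..<T}" "x \<in> X"
    and maxt: "\<And>t'. t' \<in> {s..<T} \<Longrightarrow> u t' x \<le> u t x"
    and maxx: "\<And>z. z \<in> X \<Longrightarrow> u t z \<le> u t x"
  shows "q t x \<le> 0"
proof -
  obtain ut ux uxx where u:
    "\<And>t x. t \<in> {s..<T} \<Longrightarrow> x \<in> X \<Longrightarrow>
      ((\<lambda>\<tau>. u \<tau> x) has_real_derivative ut t x) (at t within {s..<T})"
    "\<And>t x. t \<in> {s..<T} \<Longrightarrow> x \<in> X \<Longrightarrow> ((\<lambda>z. u t z) has_real_derivative ux t x) (at x)"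
    "\<And>t x. t \<in> {s..<T} \<Longrightarrow> x \<in> X \<Longrightarrow> ((\<lambda>z. ux t z) has_real_derivative uxx t x) (at x)"
    "\<And>t x. t \<in> {s..<T} \<Longrightarrow> x \<in> X \<Longrightarrow> ut t x + \<kappa> * uxx t x = q t x"
    using assms(1) by (rule has_heat_sourceE) blast
  have xx: "uxx t x \<le> 0"
    using second_derivative_at_max_nonpos[of X x "u t" "ux t"] assms u(2,3) by blast
  have tt: "ut t x \<le> 0"
  proof (rule ccontr)
    assume "\<not> ?thesis"
    then obtain d where d: "d > 0"
        "\<And>h. h > 0 \<Longrightarrow> t + h \<in> {s..<T} \<Longrightarrow> h < d \<Longrightarrow> u t x < u (t + h) x"
      using has_real_derivative_pos_inc_right[OF u(1)[OF assms(4,5)]] by auto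
    define h where "h = min d (T - t) / 2"
    have "h > 0" "h < d" "t + h \<in> {s..<T}" using d assms(4) by (auto simp: h_def min_def field_simps)
    with d(2)[of h] maxt[of "t + h"] show False by auto
  qed
  show ?thesis using u(4)[OF assms(4,5)] xx tt assms(2)
    by (smt (verit) mult_nonneg_nonpos)
qed

text \<open>A maximum over the compact cylinder cannot lie at an interior point before time
  \<open>T\<close>, since the source is strictly positive there. Hence it lies on the parabolic
  boundary, where \<open>v \<le> 0\<close>.\<close>

lemma heat_maximum_principle_compact:
  assumes "compact K" and cont: "continuous_on ({s..T} \<times> K) (\<lambda>(t, x). v t x)"
    and src: "has_heat_source \<kappa> s T (interior K) v q" and "\<kappa> \<ge> 0"
    and q: "\<And>t x. t \<in> {s..<T} \<Longrightarrow> x \<in> interior K \<Longrightarrow> q t x > 0"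
    and bdry: "\<And>t x. t \<in> {s..T} \<Longrightarrow> x \<in> K \<Longrightarrow> t = T \<or> x \<notin> interior K \<Longrightarrow> v t x \<le> 0"
    and tx: "t \<in> {s..T}" "x \<in> K"
  shows "v t x \<le> 0"
proof -
  have "compact ({s..T} \<times> K)" using assms(1) by (intro compact_Times) auto
  then obtain p where p: "p \<in> {s..T} \<times> K"
      and pmax: "\<And>p'. p' \<in> {s..T} \<times> K \<Longrightarrow> (\<lambda>(t, x). v t x) p' \<le> (\<lambda>(t, x). v t x) p"
    using continuous_attains_sup[OF _ _ cont] tx by blast
  obtain t1 x1 where [simp]: "p = (t1, x1)" by (cases p)
  have m: "\<And>t x. t \<in> {s..T} \<Longrightarrow> x \<in> K \<Longrightarrow> v t x \<le> v t1 x1" using pmax by fastforce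
  have p1: "t1 \<in> {s..T}" "x1 \<in> K" using p by auto
  have "t1 = T \<or> x1 \<notin> interior K"
  proof (rule ccontr)
    assume "\<not> ?thesis"
    then have i: "t1 \<in> {s..<T}" "x1 \<in> interior K" using p1 by auto
    have "q t1 x1 \<le> 0"
      using p1 interior_subset
      by (intro heat_source_at_max_nonpos[OF src assms(4) open_interior i] m) auto
    with q[OF i] show False by simp
  qed
  then show ?thesis using m[OF tx] bdry[OF p1] by simp
qed

text \<open>Degree four dominates quadratic growth at infinity, and for large \<open>K\<close> the
  exponential factor makes the source negative.\<close>

lemma quartic_barrier_heat_source:
  "has_heat_source \<kappa> s T X (\<lambda>t x. exp (K * (T - t)) * (1 + x\<^sup>2)\<^sup>2)
     (\<lambda>t x. exp (K * (T - t)) * (\<kappa> * (4 * (1 + x\<^sup>2) + 8 * x\<^sup>2) - K * (1 + x\<^sup>2)\<^sup>2))"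
proof (rule has_heat_sourceI)
  fix t x :: real
  show "((\<lambda>\<tau>. exp (K * (T - \<tau>)) * (1 + x\<^sup>2)\<^sup>2) has_real_derivative
      - K * exp (K * (T - t)) * (1 + x\<^sup>2)\<^sup>2) (at t within {s..<T})"
    by (auto intro!: derivative_eq_intros)
  show "((\<lambda>z. exp (K * (T - t)) * (1 + z\<^sup>2)\<^sup>2) has_real_derivative
      exp (K * (T - t)) * (4 * x * (1 + x\<^sup>2))) (at x)"
    by (auto intro!: derivative_eq_intros)
  show "((\<lambda>z. exp (K * (T - t)) * (4 * z * (1 + z\<^sup>2))) has_real_derivative
      exp (K * (T - t)) * (4 * (1 + x\<^sup>2) + 8 * x\<^sup>2)) (at x)"
    by (auto intro!: derivative_eq_intros simp: power2_eq_square algebra_simps)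
  show "- K * exp (K * (T - t)) * (1 + x\<^sup>2)\<^sup>2 + \<kappa> * (exp (K * (T - t)) * (4 * (1 + x\<^sup>2) + 8 * x\<^sup>2)) =
      exp (K * (T - t)) * (\<kappa> * (4 * (1 + x\<^sup>2) + 8 * x\<^sup>2) - K * (1 + x\<^sup>2)\<^sup>2)"
    by (simp add: algebra_simps)
qed

text \<open>Subtracting \<open>e\<close> times the quartic barrier makes the source strictly
  positive and the function nonpositive at \<open>\<bar>x\<bar> = R\<close>, so the compact case
  applies on a large interval. Since \<open>e > 0\<close> is arbitrary, the barrier can be
  removed.\<close>

lemma heat_maximum_principle:
  assumes "closed X" and cont: "continuous_on ({s..T} \<times> X) (\<lambda>(t, x). u t x)"
    and src: "has_heat_source \<kappa> s T (interior X) u q" and "\<kappa> \<ge> 0"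
    and q: "\<And>t x. t \<in> {s..<T} \<Longrightarrow> x \<in> interior X \<Longrightarrow> q t x \<ge> 0"
    and growth: "\<And>t x. t \<in> {s..T} \<Longrightarrow> x \<in> X \<Longrightarrow> u t x \<le> C * (1 + x\<^sup>2)"
    and bdry: "\<And>t x. t \<in> {s..T} \<Longrightarrow> x \<in> X \<Longrightarrow> t = T \<or> x \<notin> interior X \<Longrightarrow> u t x \<le> 0"
    and tx: "t \<in> {s..T}" "x \<in> X"
  shows "u t x \<le> 0"
proof -
  \<comment> \<open>\<open>4 (1 + x^2) + 8 x^2 \<le> 12 (1 + x^2)^2\<close>, so any
    \<open>K > 12 \<kappa>\<close> gives the barrier a negative source.\<close>
  define K where "K = 12 * \<kappa> + 1"
  define \<phi> where "\<phi> t x = exp (K * (T - t)) * (1 + x\<^sup>2)\<^sup>2" for t x :: real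
  have \<phi>_ge: "\<phi> t x \<ge> (1 + x\<^sup>2)\<^sup>2" if "t \<le> T" for t x
  proof -
    have "exp (K * (T - t)) \<ge> 1" using that assms(4) by (simp add: K_def)
    then show ?thesis unfolding \<phi>_def by (simp add: mult_le_cancel_right1)
  qed
  have main: "u t x \<le> e * \<phi> t x" if e: "e > 0" for e
  proof -
    \<comment> \<open>The three summands put the given point inside the interval, ensure
      \<open>R \<le> R^2\<close>, and make \<open>e (1 + R^2)\<close> at least
      \<open>C\<close>.\<close>
    define R where "R = \<bar>x\<bar> + 1 + \<bar>C\<bar> / e"
    have R1: "R \<ge> 1" "R \<ge> \<bar>C\<bar> / e" "\<bar>x\<bar> < R" using e by (auto simp: R_def add_pos_nonneg)
    have CR: "C \<le> e * (1 + R\<^sup>2)"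
    proof -
      have "R \<le> R\<^sup>2" using R1 by (simp add: power2_eq_square mult_le_cancel_right1)
      then have "\<bar>C\<bar> / e \<le> 1 + R\<^sup>2" using R1 by linarith
      then show ?thesis using e by (simp add: field_simps)
    qed
    define v where "v t x = u t x - e * \<phi> t x" for t x
    have int: "interior (X \<inter> {-R..R}) = interior X \<inter> {-R<..<R}" by simp
    have src_v: "has_heat_source \<kappa> s T (interior (X \<inter> {-R..R})) v
       (\<lambda>t x. q t x - e * (exp (K * (T - t)) * (\<kappa> * (4 * (1 + x\<^sup>2) + 8 * x\<^sup>2) - K * (1 + x\<^sup>2)\<^sup>2)))"
      using has_heat_source_lincomb[OF has_heat_source_subset[OF src order_refl order_refl]
          quartic_barrier_heat_source, of "interior (X \<inter> {-R..R})" "-e" K]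
      unfolding v_def \<phi>_def by (simp add: int)
    have "v t x \<le> 0"
    proof (rule heat_maximum_principle_compact[OF _ _ src_v assms(4)])
      show "compact (X \<inter> {-R..R})" using assms(1) by (simp add: closed_Int_compact)
      have "continuous_on ({s..T} \<times> (X \<inter> {-R..R})) (\<lambda>(t, x). u t x)"
        using cont by (rule continuous_on_subset) auto
      then show "continuous_on ({s..T} \<times> (X \<inter> {-R..R})) (\<lambda>(t, x). v t x)"
        unfolding v_def \<phi>_def case_prod_unfold by (intro continuous_intros) auto
    next
      fix t x assume t: "t \<in> {s..<T}" and x: "x \<in> interior (X \<inter> {-R..R})"
      define P where "P = (1 + x\<^sup>2)\<^sup>2"
      define Q where "Q = 4 * (1 + x\<^sup>2) + 8 * x\<^sup>2"
      have P: "P > 0" "1 + x\<^sup>2 \<le> P"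
        using self_le_power[of "1 + x\<^sup>2" 2] add_pos_nonneg[of 1 "x\<^sup>2"] by (simp_all add: P_def)
      have "Q \<le> 12 * (1 + x\<^sup>2)" by (simp add: Q_def)
      also have "\<dots> \<le> 12 * P" using P by (intro mult_left_mono) auto
      finally have "Q \<le> 12 * P" .
      then have "\<kappa> * Q \<le> \<kappa> * (12 * P)" using assms(4) by (rule mult_left_mono)
      also have "\<dots> < K * P" unfolding K_def distrib_right using P by simp
      finally have "e * (exp (K * (T - t)) * (\<kappa> * Q - K * P)) < 0"
        using e by (intro mult_pos_neg) auto
      moreover have "q t x \<ge> 0" using q[OF t] x int by auto
      ultimately have "0 < q t x - e * (exp (K * (T - t)) * (\<kappa> * Q - K * P))" by linarith
      then show "0 < q t x - e * (exp (K * (T - t)) * (\<kappa> * (4 * (1 + x\<^sup>2) + 8 * x\<^sup>2) - K * (1 + x\<^sup>2)\<^sup>2))"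
        unfolding P_def Q_def .
    next
      fix t x assume t: "t \<in> {s..T}" and x: "x \<in> X \<inter> {-R..R}"
        and b: "t = T \<or> x \<notin> interior (X \<inter> {-R..R})"
      have \<phi>t: "\<phi> t x \<ge> (1 + x\<^sup>2)\<^sup>2" using \<phi>_ge t by auto
      have pos: "e * \<phi> t x \<ge> 0" unfolding \<phi>_def using e by simp
      show "v t x \<le> 0"
      proof (cases "t = T \<or> x \<notin> interior X")
        case True
        then have "u t x \<le> 0" using bdry t x by auto
        then show ?thesis using pos unfolding v_def by linarith
      next
        case False
        then have "\<bar>x\<bar> = R" using b x int by auto
        then have x2: "x\<^sup>2 = R\<^sup>2" by (metis power2_abs)
        have "u t x \<le> C * (1 + R\<^sup>2)" using growth[of t x] t x unfolding x2 by auto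
        also have "\<dots> \<le> e * (1 + R\<^sup>2) * (1 + R\<^sup>2)" using CR by (intro mult_right_mono) auto
        also have "\<dots> = e * (1 + x\<^sup>2)\<^sup>2" using x2 by (simp add: power2_eq_square[of "1 + R\<^sup>2"])
        also have "\<dots> \<le> e * \<phi> t x" using \<phi>t e by simp
        finally show ?thesis unfolding v_def by simp
      qed
    qed (use tx R1 in auto)
    then show ?thesis unfolding v_def by simp
  qed
  have "\<phi> t x > 0" unfolding \<phi>_def by (intro mult_pos_pos zero_less_power add_pos_nonneg) auto
  show ?thesis
  proof (rule ccontr)
    assume "\<not> ?thesis"
    \<comment> \<open>With this \<open>e\<close> the bound reads
      \<open>u t x \<le> u t x / 2\<close>, which is impossible for a positive value.\<close>
    with \<open>\<phi> t x > 0\<close> main[of "u t x / (2 * \<phi> t x)"] show False by simp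
  qed
qed

section \<open>Strict negativity by a sinh barrier\<close>

text \<open>\<open>sinh (c (x - b))\<close> is an eigenfunction of the second derivative with
  eigenvalue \<open>c^2\<close>, which the exponential in time compensates. The free constant
  \<open>d\<close> serves to push the barrier below zero on part of the boundary.\<close>

lemma sinh_barrier_heat_source:
  "has_heat_source \<kappa> s T X (\<lambda>t x. exp (c\<^sup>2 * \<kappa> * (T - t)) * sinh (c * (x - b)) - d) (\<lambda>t x. 0)"
proof (rule has_heat_sourceI)
  fix t x :: real
  show "((\<lambda>\<tau>. exp (c\<^sup>2 * \<kappa> * (T - \<tau>)) * sinh (c * (x - b)) - d) has_real_derivative
      - (c\<^sup>2 * \<kappa>) * exp (c\<^sup>2 * \<kappa> * (T - t)) * sinh (c * (x - b))) (at t within {s..<T})"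
    by (auto intro!: derivative_eq_intros)
  show "((\<lambda>z. exp (c\<^sup>2 * \<kappa> * (T - t)) * sinh (c * (z - b)) - d) has_real_derivative
      exp (c\<^sup>2 * \<kappa> * (T - t)) * (c * cosh (c * (x - b)))) (at x)"
    by (auto intro!: derivative_eq_intros)
  show "((\<lambda>z. exp (c\<^sup>2 * \<kappa> * (T - t)) * (c * cosh (c * (z - b)))) has_real_derivative
      exp (c\<^sup>2 * \<kappa> * (T - t)) * (c\<^sup>2 * sinh (c * (x - b)))) (at x)"
    by (auto intro!: derivative_eq_intros simp: power2_eq_square)
qed simp

text \<open>At a point \<open>L > M\<close> the value 0 would be a maximum, which the positive
  source forbids; so \<open>u\<close> is negative there. The sinh barrier carries this negativity
  from the side \<open>x = L\<close> to the point \<open>x0\<close>, where the source may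
  vanish.\<close>

lemma heat_strict_negativity:
  assumes cont: "continuous_on ({s..<T} \<times> {b..}) (\<lambda>(t, x). u t x)"
    and src: "has_heat_source \<kappa> s T {b<..} u q" and "\<kappa> > 0"
    and q: "\<And>t x. t \<in> {s..<T} \<Longrightarrow> x > b \<Longrightarrow> q t x \<ge> 0"
    and q_pos: "\<And>t x. t \<in> {s..<T} \<Longrightarrow> x > b \<Longrightarrow> x > M \<Longrightarrow> q t x > 0"
    and u: "\<And>t x. t \<in> {s..<T} \<Longrightarrow> x \<ge> b \<Longrightarrow> u t x \<le> 0"
    and t0: "t0 \<in> {s..<T}" and x0: "x0 > b"
  shows "u t0 x0 < 0"
proof -
  \<comment> \<open>\<open>L\<close> lies to the right of both \<open>x0\<close> and
    \<open>M\<close>: the point is inside the strip, and the source is positive on its side.\<close>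
  define L where "L = max x0 M + 1"
  \<comment> \<open>Stopping before \<open>T\<close> stays where \<open>u\<close> is known to be
    continuous; on the compact interval \<open>{t0..t1}\<close> the negative values at
    \<open>L\<close> have a uniform bound \<open>- \<delta>\<close>.\<close>
  define t1 where "t1 = (t0 + T) / 2"
  have L: "L > b" "L > M" "L > x0" using x0 by (auto simp: L_def)
  have t1: "t0 < t1" "t1 < T" "s \<le> t0" using t0 by (auto simp: t1_def)
  have side: "u t L < 0" if t: "t \<in> {t0..t1}" for t
  proof (rule ccontr)
    assume "\<not> ?thesis"
    moreover have t': "t \<in> {s..<T}" using t t1 by auto
    ultimately have "u t L = 0" using u[OF t', of L] L by auto
    then have "q t L \<le> 0"
      using L u t' \<open>\<kappa> > 0\<close> by (intro heat_source_at_max_nonpos[OF src _ _ t']) auto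
    with q_pos[OF t', of L] L show False by auto
  qed
  have "continuous_on {t0..t1} (\<lambda>t. (\<lambda>(t, x). u t x) (t, L))"
    by (rule continuous_on_compose2[OF cont]) (use t1 L in \<open>auto intro!: continuous_intros\<close>)
  then have "continuous_on {t0..t1} (\<lambda>t. u t L)" by simp
  then obtain tm where tm: "tm \<in> {t0..t1}" "\<And>t. t \<in> {t0..t1} \<Longrightarrow> u t L \<le> u tm L"
    using continuous_attains_sup[of "{t0..t1}" "\<lambda>t. u t L"] t1 by auto
  define \<delta> where "\<delta> = - u tm L"
  have \<delta>: "\<delta> > 0" "\<And>t. t \<in> {t0..t1} \<Longrightarrow> u t L \<le> - \<delta>"
    using tm side[of tm] by (auto simp: \<delta>_def)
  \<comment> \<open>With this \<open>c\<close> the growth \<open>exp (c\<^sup>2 \<kappa> (t1 - t0))\<close> beats \<open>sinh (c (L - b))\<close>.\<close>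
  define c where "c = 1 / (x0 - b) + (L - b) / (\<kappa> * (t1 - t0))"
  have c: "c > 0" "c * (x0 - b) \<ge> 1" "c * (L - b) \<le> c\<^sup>2 * \<kappa> * (t1 - t0)"
  proof -
    show c0: "c > 0" using x0 L t1 \<open>\<kappa> > 0\<close> by (auto simp: c_def intro!: add_pos_pos divide_pos_pos)
    have "1 / (x0 - b) \<le> c" using x0 L t1 \<open>\<kappa> > 0\<close> by (simp add: c_def)
    then show "c * (x0 - b) \<ge> 1" using x0 by (simp add: divide_le_eq)
    have "(L - b) / (\<kappa> * (t1 - t0)) \<le> c" using x0 by (simp add: c_def)
    then have "L - b \<le> c * (\<kappa> * (t1 - t0))" using t1 \<open>\<kappa> > 0\<close> by (subst (asm) pos_divide_le_eq) auto
    then have "c * (L - b) \<le> c * (c * (\<kappa> * (t1 - t0)))" using c0 by (intro mult_left_mono) auto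
    then show "c * (L - b) \<le> c\<^sup>2 * \<kappa> * (t1 - t0)" by (simp add: power2_eq_square mult.assoc)
  qed
  \<comment> \<open>The subtracted constant makes \<open>B \<le> 0\<close> both at time
    \<open>t1\<close> and on the side \<open>x = b\<close>.\<close>
  define B where "B t x = exp (c\<^sup>2 * \<kappa> * (t1 - t)) * sinh (c * (x - b)) - sinh (c * (L - b))" for t x
  define E where "E = exp (c\<^sup>2 * \<kappa> * (t1 - t0)) * sinh (c * (L - b))"
  \<comment> \<open>\<open>E\<close> bounds \<open>B\<close> on the whole rectangle, so
    \<open>\<epsilon> B \<le> \<delta>\<close>, which \<open>u \<le> - \<delta>\<close> absorbs on
    the side \<open>x = L\<close>.\<close>
  define \<epsilon> where "\<epsilon> = \<delta> / E"
  have sL: "sinh (c * (L - b)) > 0" using c L by simp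
  have E: "E > 0" unfolding E_def using sL by simp
  have \<epsilon>: "\<epsilon> > 0" using E \<delta> by (simp add: \<epsilon>_def)
  have BE: "B t x \<le> E" if "t \<in> {t0..t1}" "x \<in> {b..L}" for t x
  proof -
    have "exp (c\<^sup>2 * \<kappa> * (t1 - t)) * sinh (c * (x - b)) \<le> E"
      unfolding E_def using that c \<open>\<kappa> > 0\<close> by (intro mult_mono) auto
    then show ?thesis using sL unfolding B_def by linarith
  qed
  have "u t0 x0 + \<epsilon> * B t0 x0 \<le> 0"
  proof (rule heat_maximum_principle[where X = "{b..L}" and s = t0 and T = t1 and \<kappa> = \<kappa>
        and u = "\<lambda>t x. u t x + \<epsilon> * B t x" and q = "\<lambda>t x. q t x + \<epsilon> * 0" and C = \<delta>])
    show "continuous_on ({t0..t1} \<times> {b..L}) (\<lambda>(t, x). u t x + \<epsilon> * B t x)"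
    proof -
      have "continuous_on ({t0..t1} \<times> {b..L}) (\<lambda>(t, x). u t x)"
        by (rule continuous_on_subset[OF cont]) (use t1 in auto)
      then show ?thesis unfolding B_def case_prod_unfold by (intro continuous_intros) auto
    qed
    show "has_heat_source \<kappa> t0 t1 (interior {b..L}) (\<lambda>t x. u t x + \<epsilon> * B t x) (\<lambda>t x. q t x + \<epsilon> * 0)"
      unfolding B_def
      by (rule has_heat_source_lincomb[OF has_heat_source_subset[OF src] sinh_barrier_heat_source])
         (use t1 in auto)
  next
    fix t x assume tx: "t \<in> {t0..t1}" "x \<in> {b..L}"
    then have t': "t \<in> {s..<T}" using t1 by auto
    have "\<epsilon> * B t x \<le> \<epsilon> * E" using BE[OF tx] \<epsilon> by (intro mult_left_mono) auto
    then have B\<delta>: "\<epsilon> * B t x \<le> \<delta>" using E by (simp add: \<epsilon>_def)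
    have ux: "u t x \<le> 0" using u[OF t'] tx by auto
    have "\<delta> \<le> \<delta> * (1 + x\<^sup>2)" using \<delta>(1) by (simp add: mult_le_cancel_left1)
    with ux B\<delta> show "u t x + \<epsilon> * B t x \<le> \<delta> * (1 + x\<^sup>2)" by linarith
    assume "t = t1 \<or> x \<notin> interior {b..L}"
    then consider "t = t1" | "x = b" | "x = L" using tx by auto
    then show "u t x + \<epsilon> * B t x \<le> 0"
    proof cases
      case 1
      then have "B t x \<le> 0" using tx c by (simp add: B_def)
      then have "\<epsilon> * B t x \<le> 0" using \<epsilon> by (simp add: mult_nonneg_nonpos)
      with ux show ?thesis by linarith
    next
      case 2
      then have "B t x \<le> 0" using sL by (simp add: B_def)
      then have "\<epsilon> * B t x \<le> 0" using \<epsilon> by (simp add: mult_nonneg_nonpos)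
      with ux show ?thesis by linarith
    next
      case 3
      then show ?thesis using \<delta>(2)[OF tx(1)] B\<delta> by simp
    qed
  next
    fix t x assume "t \<in> {t0..<t1}" "x \<in> interior {b..L}"
    then show "q t x + \<epsilon> * 0 \<ge> 0" using q t1 by auto
  qed (use t1 x0 L \<open>\<kappa> > 0\<close> in auto)
  moreover have "B t0 x0 > 0"
  proof -
    have sinh_half: "sinh y = (exp y - exp (- y)) / 2" for y :: real
      by (simp add: sinh_def field_simps)
    have half: "sinh y \<ge> 1 / 2" if "y \<ge> 1" for y :: real
    proof -
      have "exp y \<ge> 2" by (rule order_trans[OF _ exp_ge_add_one_self]) (use that in simp)
      moreover have "exp (- y) \<le> 1" using that by simp
      ultimately have "2 - 1 \<le> exp y - exp (- y)" by (rule diff_mono)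
      then show ?thesis unfolding sinh_half by simp
    qed
    \<comment> \<open>The choice of \<open>c\<close> enters here: \<open>c (x0 - b) \<ge> 1\<close>
      gives \<open>sinh (c (x0 - b)) \<ge> 1/2\<close>, and the exponential in time dominates
      \<open>exp (c (L - b))\<close>.\<close>
    have "sinh (c * (L - b)) < exp (c * (L - b)) * (1 / 2)" unfolding sinh_half by simp
    also have "\<dots> \<le> exp (c\<^sup>2 * \<kappa> * (t1 - t0)) * sinh (c * (x0 - b))"
      using c half by (intro mult_mono) auto
    finally show ?thesis by (simp add: B_def)
  qed
  then have "\<epsilon> * B t0 x0 > 0" using \<epsilon> by simp
  ultimately show ?thesis by linarith
qed

subsection \<open>Shape of solutions of the heat problem\<close>

text \<open>The situation after the drift is removed. Properties of the source enter as hypotheses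
  of the individual lemmas, each turned into the corresponding shape of \<open>g\<close>.\<close>

locale heat_problem =
  fixes \<kappa> T C :: real and g q :: "real \<Rightarrow> real \<Rightarrow> real"
  assumes \<kappa>: "\<kappa> > 0"
    and cont: "continuous_on ({0..T} \<times> UNIV) (\<lambda>(t, x). g t x)"
    and src: "has_heat_source \<kappa> 0 T UNIV g q"
    and growth: "\<And>t x. t \<in> {0..T} \<Longrightarrow> \<bar>g t x\<bar> \<le> C * (1 + x\<^sup>2)"
    and final: "\<And>x. g T x = 0"
begin

lemma C_nonneg:
  assumes "t \<in> {0..T}"
  shows "C \<ge> 0"
  using growth[OF assms, of 0] by auto

text \<open>The parallelogram identity gives \<open>(c + m x)^2 \<le> 2 c^2 + 2 x^2\<close>. This
  keeps translates and reflections of \<open>g\<close> within the growth class of the maximum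
  principle.\<close>

lemma growth_isometry:
  assumes t: "t \<in> {0..T}" and m: "m\<^sup>2 = 1"
  shows "\<bar>g t (c + m * x)\<bar> \<le> C * (2 + 2 * c\<^sup>2) * (1 + x\<^sup>2)"
proof -
  have "(c + m * x)\<^sup>2 + (c - m * x)\<^sup>2 = 2 * c\<^sup>2 + 2 * m\<^sup>2 * x\<^sup>2"
    by (simp add: power2_eq_square algebra_simps)
  then have "(c + m * x)\<^sup>2 \<le> 2 * c\<^sup>2 + 2 * x\<^sup>2"
    using zero_le_power2[of "c - m * x"] unfolding m by linarith
  moreover have "(2 + 2 * c\<^sup>2) * (1 + x\<^sup>2) = 2 + 2 * c\<^sup>2 + 2 * x\<^sup>2 + 2 * (c\<^sup>2 * x\<^sup>2)"
    by (simp add: algebra_simps)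
  moreover have "c\<^sup>2 * x\<^sup>2 \<ge> 0" by simp
  ultimately have "1 + (c + m * x)\<^sup>2 \<le> (2 + 2 * c\<^sup>2) * (1 + x\<^sup>2)" by linarith
  then have "C * (1 + (c + m * x)\<^sup>2) \<le> C * ((2 + 2 * c\<^sup>2) * (1 + x\<^sup>2))"
    using C_nonneg[OF t] by (rule mult_left_mono)
  with growth[OF t, of "c + m * x"] show ?thesis by (simp add: mult.assoc)
qed

lemma cont_isometry:
  "continuous_on ({0..T} \<times> X) (\<lambda>(t, x). g t (c + m * x))"
proof -
  have "continuous_on ({0..T} \<times> X) (\<lambda>p. (\<lambda>(t, x). g t x) (fst p, c + m * snd p))"
    by (rule continuous_on_compose2[OF cont]) (auto intro!: continuous_intros)
  then show ?thesis by (simp add: case_prod_unfold)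
qed

lemma nonpos:
  assumes "\<And>t x. t \<in> {0..<T} \<Longrightarrow> q t x \<ge> 0" and "t \<in> {0..T}"
  shows "g t x \<le> 0"
proof (rule heat_maximum_principle[OF closed_UNIV cont _ less_imp_le[OF \<kappa>], of q C])
  show "g t x \<le> C * (1 + x\<^sup>2)" if "t \<in> {0..T}" for t x
    using growth[OF that] by (rule abs_le_D1)
qed (use assms src final in auto)

text \<open>\<open>c - x\<close> is the reflection of \<open>x\<close> about \<open>c / 2\<close>,
  so this difference vanishes at \<open>x = c / 2\<close>. It is used with \<open>c = 0\<close> for
  evenness and with \<open>c = 2 b\<close> for monotonicity.\<close>

lemma mirror:
  "has_heat_source \<kappa> 0 T UNIV (\<lambda>t x. g t x - g t (c - x)) (\<lambda>t x. q t x - q t (c - x))"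
  using has_heat_source_diff[OF src has_heat_source_isometry[OF src, of "- 1" c]] by simp

lemma mirror_cont:
  "continuous_on ({0..T} \<times> X) (\<lambda>(t, x). g t x - g t (c - x))"
  using continuous_on_diff[OF cont_isometry[of X 0 1] cont_isometry[of X c "- 1"]]
  by (simp add: case_prod_unfold)

lemma mirror_growth:
  assumes "t \<in> {0..T}"
  shows "g t x - g t (c - x) \<le> (C * 2 + C * (2 + 2 * c\<^sup>2)) * (1 + x\<^sup>2)"
  using growth_isometry[OF assms, of 1 0 x] growth_isometry[OF assms, of "- 1" c x]
  by (simp add: distrib_right)

text \<open>The difference of \<open>g\<close> and its reflection about 0 has source 0 and final
  value 0, so it is nonpositive; applying this at \<open>x\<close> and at \<open>- x\<close> gives
  equality.\<close>

lemma even_in_space: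
  assumes q_even: "\<And>t x. t \<in> {0..<T} \<Longrightarrow> q t (- x) = q t x" and t: "t \<in> {0..T}"
  shows "g t (- x) = g t x"
proof -
  have "g t x - g t (0 - x) \<le> 0" for x
    by (rule heat_maximum_principle[OF closed_UNIV mirror_cont _ less_imp_le[OF \<kappa>] _ mirror_growth])
       (use q_even t final mirror[of 0] in auto)
  from this[of x] this[of "- x"] show ?thesis by simp
qed

text \<open>Concavity in derivative-free form: the mixed second difference of \<open>g\<close> with
  steps \<open>k\<close> and \<open>l\<close> solves the heat equation with the same second
  difference of \<open>q\<close> as source.\<close>

lemma second_difference_nonpos:
  assumes q_convex: "\<And>t x. t \<in> {0..<T} \<Longrightarrow> q t (x + k) + q t (x + l) \<le> q t (x + k + l) + q t x"
    and t: "t \<in> {0..T}"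
  shows "g t (x + k + l) + g t x \<le> g t (x + k) + g t (x + l)"
proof -
  \<comment> \<open>The factors \<open>1 * x\<close> match the pattern \<open>c + m * x\<close> of
    the isometry lemmas.\<close>
  define v where "v t x = (g t (k + l + 1 * x) - g t (k + 1 * x)) - (g t (l + 1 * x) - g t x)" for t x
  define p where "p t x = (q t (k + l + 1 * x) - q t (k + 1 * x)) - (q t (l + 1 * x) - q t x)" for t x
  define D where "D = C * (2 + 2 * (k + l)\<^sup>2) + C * (2 + 2 * k\<^sup>2) + C * (2 + 2 * l\<^sup>2) + C"
  have "v t x \<le> 0"
  proof (rule heat_maximum_principle[OF closed_UNIV _ _ less_imp_le[OF \<kappa>], of 0 T v p D])
    show "continuous_on ({0..T} \<times> UNIV) (\<lambda>(t, x). v t x)"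
      unfolding v_def using cont_isometry[of UNIV "k + l" 1] cont_isometry[of UNIV k 1]
        cont_isometry[of UNIV l 1] cont
      by (auto simp: case_prod_unfold intro!: continuous_on_diff)
    have "has_heat_source \<kappa> 0 T UNIV v p"
      unfolding v_def p_def by (intro has_heat_source_diff has_heat_source_isometry src) auto
    then show "has_heat_source \<kappa> 0 T (interior UNIV) v p" by simp
  next
    fix t x assume "t \<in> {0..<T}"
    then show "p t x \<ge> 0" using q_convex[of t x] by (simp add: p_def algebra_simps)
  next
    fix t x assume t: "t \<in> {0..T}"
    have 1: "(1::real)\<^sup>2 = 1" by simp
    show "v t x \<le> D * (1 + x\<^sup>2)"
      using growth_isometry[OF t 1, of "k + l" x] growth_isometry[OF t 1, of k x]
        growth_isometry[OF t 1, of l x] growth[OF t, of x]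
      unfolding v_def D_def distrib_right[of _ _ "1 + x\<^sup>2"] by linarith
  next
    fix t x :: real assume "t = T \<or> x \<notin> interior UNIV"
    then show "v t x \<le> 0" by (auto simp: v_def final)
  qed (use t in auto)
  then show ?thesis by (simp add: v_def algebra_simps)
qed

text \<open>Steps \<open>y - x\<close> and \<open>h\<close> in the second difference bound the
  difference quotient at \<open>y\<close> by the one at \<open>x\<close>; then \<open>h\<close>
  tends to 0 from the right.\<close>

lemma derivative_antimono:
  assumes q_convex: "\<And>t x k l. t \<in> {0..<T} \<Longrightarrow> k \<ge> 0 \<Longrightarrow> l \<ge> 0 \<Longrightarrow>
      q t (x + k) + q t (x + l) \<le> q t (x + k + l) + q t x"
    and t: "t \<in> {0..T}" and "x \<le> y"
    and x: "(g t has_real_derivative dx) (at x)" and y: "(g t has_real_derivative dy) (at y)"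
  shows "dy \<le> dx"
proof -
  have quot: "((\<lambda>h. (g t (z + h) - g t z) / h) \<longlongrightarrow> d) (at_right 0)"
    if "(g t has_real_derivative d) (at z)" for z d
    using that unfolding DERIV_def by (rule tendsto_mono[rotated]) (simp add: at_le)
  have "(g t (y + h) - g t y) / h \<le> (g t (x + h) - g t x) / h" if "h > 0" for h
    using second_difference_nonpos[of "y - x" h t x] q_convex[of _ "y - x" h] t \<open>x \<le> y\<close> that
    by (intro divide_right_mono) auto
  then have "eventually (\<lambda>h. (g t (y + h) - g t y) / h \<le> (g t (x + h) - g t x) / h) (at_right 0)"
    by (auto intro: eventually_at_right_less[THEN eventually_mono])
  then show ?thesis by (rule tendsto_le[OF trivial_limit_at_right_real quot[OF x] quot[OF y]])
qed

text \<open>Strict negativity is applied on the half-line from \<open>x - 1\<close>, which has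
  \<open>x\<close> in its interior.\<close>

lemma negative:
  assumes q: "\<And>t x. t \<in> {0..<T} \<Longrightarrow> q t x \<ge> 0"
    and q_pos: "\<And>t x. t \<in> {0..<T} \<Longrightarrow> x > M \<Longrightarrow> q t x > 0"
    and t: "t \<in> {0..<T}"
  shows "g t x < 0"
proof (rule heat_strict_negativity[of 0 T "x - 1" g \<kappa> q M])
  show "continuous_on ({0..<T} \<times> {x - 1..}) (\<lambda>(t, x). g t x)"
    by (rule continuous_on_subset[OF cont]) auto
  show "has_heat_source \<kappa> 0 T {x - 1<..} g q"
    by (rule has_heat_source_subset[OF src]) auto
qed (use q q_pos t \<kappa> nonpos[OF q] in auto)

text \<open>Reflection about the midpoint \<open>b > 0\<close> of \<open>x\<close> and
  \<open>y\<close> exchanges the two points. For \<open>z > b\<close> the reflected point satisfies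
  \<open>\<bar>2 b - z\<bar> < z\<close>, so the source of the mirror difference is nonnegative, and
  positive for \<open>z > M\<close>.\<close>

lemma strictly_decreasing_in_abs:
  assumes q: "\<And>t x y. t \<in> {0..<T} \<Longrightarrow> \<bar>y\<bar> \<le> x \<Longrightarrow> q t y \<le> q t x"
    and q_strict: "\<And>t x y. t \<in> {0..<T} \<Longrightarrow> \<bar>y\<bar> < x \<Longrightarrow> x > M \<Longrightarrow> q t y < q t x"
    and t: "t \<in> {0..<T}" and xy: "\<bar>y\<bar> < x"
  shows "g t x < g t y"
proof -
  define b where "b = (x + y) / 2"
  have b: "b > 0" "x > b" using xy by (auto simp: b_def)
  have int: "interior {b..} = {b<..}" by simp
  have src_b: "has_heat_source \<kappa> 0 T {b<..} (\<lambda>t x. g t x - g t (2 * b - x)) (\<lambda>t x. q t x - q t (2 * b - x))"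
    by (rule has_heat_source_subset[OF mirror]) auto
  have nonneg: "0 \<le> q t z - q t (2 * b - z)" if "t \<in> {0..<T}" "z > b" for t z
    using q[OF that(1), of "2 * b - z" z] that b by auto
  have nonpos: "g t z - g t (2 * b - z) \<le> 0" if "t \<in> {0..T}" "z \<ge> b" for t z
  proof (rule heat_maximum_principle[OF closed_atLeast mirror_cont _ less_imp_le[OF \<kappa>] _ mirror_growth])
    fix s z assume "z \<in> {b..}" "s = T \<or> z \<notin> interior {b..}"
    then have "s = T \<or> z = b" by auto
    then show "g s z - g s (2 * b - z) \<le> 0" by (auto simp: final)
  qed (use src_b nonneg that int in auto)
  have "g t x - g t (2 * b - x) < 0"
  proof (rule heat_strict_negativity[OF _ src_b \<kappa>, of M])
    show "continuous_on ({0..<T} \<times> {b..}) (\<lambda>(t, x). g t x - g t (2 * b - x))"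
      by (rule continuous_on_subset[OF mirror_cont[of UNIV]]) auto
    fix t z assume "t \<in> {0..<T}" "z > b" "z > M"
    then show "0 < q t z - q t (2 * b - z)" using q_strict[of t "2 * b - z" z] b by auto
  qed (use t b nonneg nonpos in auto)
  then show ?thesis by (simp add: b_def field_simps)
qed

end

subsection \<open>Reduction to the heat equation\<close>

text \<open>For \<open>c \<ge> 0\<close> this is the squared distance from \<open>y\<close> to the
  interval \<open>[-c, c]\<close>, a form that shows evenness, monotonicity and convexity.\<close>

definition excess :: "real \<Rightarrow> real \<Rightarrow> real" where
  "excess c y = (max 0 (\<bar>y\<bar> - c))\<^sup>2"

lemma excess_nonneg: "excess c y \<ge> 0"
  by (simp add: excess_def)

lemma excess_uminus: "excess c (- y) = excess c y"
  by (simp add: excess_def)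

lemma excess_mono: "\<bar>y\<bar> \<le> \<bar>x\<bar> \<Longrightarrow> excess c y \<le> excess c x"
  unfolding excess_def by (intro power_mono) auto

lemma excess_strict_mono: "\<bar>y\<bar> < \<bar>x\<bar> \<Longrightarrow> \<bar>x\<bar> > c \<Longrightarrow> excess c y < excess c x"
  unfolding excess_def by (intro power_strict_mono) auto

text \<open>For \<open>c \<ge> 0\<close> the two indicators overlap only if
  \<open>c = y = 0\<close>, where both squares vanish.\<close>

lemma excess_eq:
  assumes "c \<ge> 0"
  shows "excess c y = (- y + c)\<^sup>2 * of_bool (- y + c \<le> 0) + (- y - c)\<^sup>2 * of_bool (- y - c \<ge> 0)"
  using assms by (cases "y > c"; cases "y < - c"; cases "\<bar>y\<bar> = c")
    (auto simp: excess_def max_def abs_if power2_eq_square algebra_simps)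

text \<open>The truncated function \<open>p\<close> is convex and nonnegative, and squaring is
  convex and monotone on nonnegative numbers.\<close>

lemma convex_excess: "convex_on UNIV (excess c)"
proof (rule convex_onI)
  fix t x y :: real assume t: "0 < t" "t < 1"
  define p where "p z = max 0 (\<bar>z\<bar> - c)" for z
  let ?z = "(1 - t) * x + t * y"
  have "\<bar>?z\<bar> \<le> (1 - t) * \<bar>x\<bar> + t * \<bar>y\<bar>"
    using abs_triangle_ineq[of "(1 - t) * x" "t * y"] t by (simp add: abs_mult)
  also have "\<dots> \<le> (1 - t) * (p x + c) + t * (p y + c)"
    using t by (intro add_mono mult_left_mono) (auto simp: p_def)
  also have "\<dots> = (1 - t) * p x + t * p y + c" by (simp add: algebra_simps)
  finally have "p ?z \<le> (1 - t) * p x + t * p y"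
    using t by (auto simp: p_def[of ?z]) (simp add: p_def)
  then have "(p ?z)\<^sup>2 \<le> ((1 - t) * p x + t * p y)\<^sup>2"
    by (intro power_mono) (auto simp: p_def)
  also have "\<dots> \<le> (1 - t) * (p x)\<^sup>2 + t * (p y)\<^sup>2"
    using convex_onD[OF convex_power2, of t "p x" "p y"] t by simp
  finally show "excess c ((1 - t) *\<^sub>R x + t *\<^sub>R y) \<le> (1 - t) * excess c x + t * excess c y"
    by (simp add: excess_def p_def)
qed auto

text \<open>\<open>x + k\<close> and \<open>x + l\<close> are convex combinations of
  \<open>x\<close> and \<open>x + k + l\<close> with exchanged weights, so the two convexity bounds
  add up to the claim.\<close>

lemma convex_on_second_difference:
  fixes f :: "real \<Rightarrow> real"
  assumes "convex_on UNIV f" "k \<ge> 0" "l \<ge> 0"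
  shows "f (x + k) + f (x + l) \<le> f (x + k + l) + f x"
proof (cases "k + l = 0")
  case False
  then have kl: "k + l > 0" using assms by auto
  define t where "t = k / (k + l)"
  have t: "0 \<le> t" "t \<le> 1" "t * (k + l) = k" using kl assms by (auto simp: t_def)
  have "(1 - t) * x + t * (x + k + l) = x + t * (k + l)"
    by (simp add: algebra_simps)
  then have eq1: "(1 - t) * x + t * (x + k + l) = x + k" using t by simp
  have "(1 - t) * (x + k + l) + t * x = x + (k + l) - t * (k + l)"
    by (simp add: algebra_simps)
  then have eq2: "(1 - t) * (x + k + l) + t * x = x + l" using t by simp
  have "f (x + k) \<le> (1 - t) * f x + t * f (x + k + l)"
    using convex_onD[OF assms(1) t(1,2), of x "x + k + l"] eq1 by simp
  moreover have "f (x + l) \<le> (1 - t) * f (x + k + l) + t * f x"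
    using convex_onD[OF assms(1) t(1,2), of "x + k + l" x] eq2 by simp
  ultimately show ?thesis by (simp add: algebra_simps)
next
  case True
  then have "k = 0" "l = 0" using assms by auto
  then show ?thesis by simp
qed

section \<open>Sign, monotonicity and derivative of \<open>gam\<close>\<close>

lemma gam_pos:
  assumes "\<sigma> > 0" "\<sigma>0 > 0" "t \<ge> 0"
  shows "gam \<sigma> \<sigma>0 t > 0"
  using assms unfolding gam_def by (auto intro!: add_pos_nonneg)

lemma gam_antimono:
  assumes "\<sigma> > 0" "\<sigma>0 > 0" "0 \<le> s" "s \<le> t"
  shows "gam \<sigma> \<sigma>0 t \<le> gam \<sigma> \<sigma>0 s"
  using assms unfolding gam_def
  by (intro le_imp_inverse_le add_left_mono mult_right_mono add_pos_nonneg) auto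

text \<open>The reciprocal of \<open>gam\<close> is affine in \<open>t\<close> with slope
  \<open>1 / \<sigma>^2\<close>. The resulting Riccati equation is what cancels the drift.\<close>

lemma gam_has_derivative:
  assumes "\<sigma> > 0" "\<sigma>0 > 0" "t \<ge> 0"
  shows "(gam \<sigma> \<sigma>0 has_real_derivative - ((gam \<sigma> \<sigma>0 t)\<^sup>2 / \<sigma>\<^sup>2)) (at t within A)"
proof -
  have "inverse (\<sigma>0\<^sup>2) + t * inverse (\<sigma>\<^sup>2) \<noteq> 0"
    using gam_pos[OF assms] by (auto simp: gam_def)
  then have "((\<lambda>t. inverse (inverse (\<sigma>0\<^sup>2) + t * inverse (\<sigma>\<^sup>2))) has_real_derivative
      - ((gam \<sigma> \<sigma>0 t)\<^sup>2 / \<sigma>\<^sup>2)) (at t within A)"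
    by (auto intro!: derivative_eq_intros simp: gam_def power2_eq_square divide_inverse)
  then show ?thesis unfolding gam_def .
qed

section \<open>Derivatives and a chain rule for functions of class \<open>C12\<close>\<close>

lemma C12_has_derivatives:
  assumes "C12 T f" "t \<in> {0..<T}"
  shows "((\<lambda>s. f s y) has_real_derivative D_t T f t y) (at t within {0..<T})"
    and "((\<lambda>x. f t x) has_real_derivative D_y f t y) (at y)"
    and "((\<lambda>x. D_y f t x) has_real_derivative D_yy f t y) (at y)"
proof -
  have "(\<lambda>s. f s y) differentiable (at t within {0..<T})" "(\<lambda>x. f t x) differentiable (at y)"
    "(\<lambda>x. D_y f t x) differentiable (at y)"
    using assms unfolding C12_def by blast+
  note diff = this
  show "((\<lambda>s. f s y) has_real_derivative D_t T f t y) (at t within {0..<T})"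
    using diff(1) by (simp add: D_t_def vector_derivative_works has_real_derivative_iff_has_vector_derivative)
  show "((\<lambda>x. f t x) has_real_derivative D_y f t y) (at y)"
    using diff(2) by (simp add: D_y_def DERIV_deriv_iff_real_differentiable)
  show "((\<lambda>x. D_y f t x) has_real_derivative D_yy f t y) (at y)"
    using diff(3) by (simp add: D_yy_def DERIV_deriv_iff_real_differentiable)
qed

text \<open>The chain rule needs the total derivative in \<open>(t, y)\<close>; it comes from the
  partial derivatives together with continuity of \<open>D_y\<close>. Working within
  \<open>{0..<T} \<times> UNIV\<close> includes \<open>t = 0\<close>.\<close>

lemma C12_has_derivative_along_curve:
  assumes f: "C12 T f" and t: "t \<in> {0..<T}"
    and z: "(z has_real_derivative z') (at t within {0..<T})"
  shows "((\<lambda>s. f s (z s)) has_real_derivative D_t T f t (z t) + D_y f t (z t) * z') (at t within {0..<T})"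
proof -
  \<comment> \<open>The partial derivative in \<open>y\<close> is packaged as a bounded linear map,
    the form in which \<open>has_derivative_partialsI\<close> expects it.\<close>
  let ?fy = "\<lambda>s y. blinfun_scaleR_left (D_y f s y) :: real \<Rightarrow>\<^sub>L real"
  have "((\<lambda>(s, y). f s y) has_derivative (\<lambda>(ds, dy). D_t T f t (z t) * ds + ?fy t (z t) dy))
      (at (t, z t) within {0..<T} \<times> UNIV)"
  proof (rule has_derivative_partialsI)
    show "((\<lambda>s. f s (z t)) has_derivative (*) (D_t T f t (z t))) (at t within {0..<T})"
      using C12_has_derivatives(1)[OF f t] by (simp add: has_field_derivative_def)
    show "((\<lambda>y. f s y) has_derivative blinfun_apply (?fy s y)) (at y within UNIV)"
      if "s \<in> {0..<T}" for s y
      using C12_has_derivatives(2)[OF f that, of y]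
      by (simp add: has_field_derivative_def mult_commute_abs blinfun_scaleR_left.rep_eq)
    have "continuous_on ({0..<T} \<times> UNIV) (\<lambda>(t, y). D_y f t y)"
      using f unfolding C12_def by blast
    then have "continuous (at (t, z t) within {0..<T} \<times> UNIV) (\<lambda>(t, y). D_y f t y)"
      using t by (simp add: continuous_on_eq_continuous_within)
    then show "continuous (at (t, z t) within {0..<T} \<times> UNIV) (\<lambda>(s, y). ?fy s y)"
      unfolding case_prod_unfold continuous_within
      by (rule bounded_linear.tendsto[OF bounded_linear_blinfun_scaleR_left])
  qed auto
  then have f': "((\<lambda>(s, y). f s y) has_derivative (\<lambda>(ds, dy). D_t T f t (z t) * ds + dy * D_y f t (z t)))
      (at (t, z t) within {0..<T} \<times> UNIV)"
    by (simp add: case_prod_unfold)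
  have "((\<lambda>s. (s, z s)) has_derivative (\<lambda>h. (h, z' * h))) (at t within {0..<T})"
    using z by (intro has_derivative_Pair has_derivative_ident) (simp add: has_field_derivative_def)
  then have "((\<lambda>s. (\<lambda>(s, y). f s y) (s, z s)) has_derivative
      (\<lambda>h. (\<lambda>(ds, dy). D_t T f t (z t) * ds + dy * D_y f t (z t)) (h, z' * h))) (at t within {0..<T})"
    by (rule has_derivative_in_compose) (rule has_derivative_subset[OF f'], auto)
  moreover have "(\<lambda>h. (\<lambda>(ds, dy). D_t T f t (z t) * ds + dy * D_y f t (z t)) (h, z' * h))
      = (*) (D_t T f t (z t) + D_y f t (z t) * z')"
    by (auto simp: fun_eq_iff algebra_simps)
  ultimately show ?thesis unfolding has_field_derivative_def by simp
qed

section \<open>Removal of the drift and transfer back to \<open>f\<close>\<close>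

theorem theorem3p4:
  fixes T \<sigma> \<sigma>0 a r :: real and f :: "real \<Rightarrow> real \<Rightarrow> real"
  assumes "T > 0" and "\<sigma> > 0" and "\<sigma>0 > 0" and "a \<ge> 0"
    and "is_solution T \<sigma> \<sigma>0 a r f"
  shows "(\<forall>t\<in>{0..<T}. \<forall>y. f t y < 0) \<and>
    (\<forall>t\<in>{0..<T}. antimono (\<lambda>y. D_y f t y)) \<and>
    (\<forall>t\<in>{0..<T}. \<forall>y<r. D_y f t y > 0) \<and>
    (\<forall>t\<in>{0..T}. D_y f t r = 0) \<and>
    (\<forall>y. D_y f T y = 0) \<and>
    (\<forall>t\<in>{0..<T}. \<forall>y>r. D_y f t y < 0)"
proof -
  have C12: "C12 T f" and cont: "continuous_on ({0..T} \<times> UNIV) (\<lambda>(t, y). f t y)"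
    and f_T: "f T y = 0" for y
    using assms(5) unfolding is_solution_def cauchy_problem_def by auto
  define G where "G = gam \<sigma> \<sigma>0"
  have G_pos: "G t > 0" if "t \<ge> 0" for t
    unfolding G_def by (rule gam_pos[OF assms(2,3) that])
  have G_le: "G t \<le> G s" if "0 \<le> s" "s \<le> t" for s t
    unfolding G_def by (rule gam_antimono[OF assms(2,3) that])
  have G_deriv: "(G has_real_derivative - ((G t)\<^sup>2 / \<sigma>\<^sup>2)) (at t within A)" if "t \<ge> 0" for t A
    unfolding G_def by (rule gam_has_derivative[OF assms(2,3) that])
  have pde: "D_t T f t y + 1 / 2 * D_yy f t y * ((G t)\<^sup>2 / \<sigma>\<^sup>2) + D_y f t y * (G t * (r - y) / \<sigma>\<^sup>2)
      = excess (a * sqrt (G t)) (y - r) / (2 * \<sigma>\<^sup>2)" if t: "t \<in> {0..<T}" for t y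
  proof -
    have "a * sqrt (G t) \<ge> 0" using assms(4) G_pos[of t] t by simp
    then have "excess (a * sqrt (G t)) (y - r) / (2 * \<sigma>\<^sup>2) =
        (r - y + a * sqrt (G t))\<^sup>2 / (2 * \<sigma>\<^sup>2) * of_bool (r - y + a * sqrt (G t) \<le> 0)
        + (r - y - a * sqrt (G t))\<^sup>2 / (2 * \<sigma>\<^sup>2) * of_bool (r - y - a * sqrt (G t) \<ge> 0)"
      by (simp add: excess_eq add_divide_distrib)
    moreover have "D_t T f t y + 1 / 2 * D_yy f t y * ((G t)\<^sup>2 / \<sigma>\<^sup>2) + D_y f t y * (G t * (r - y) / \<sigma>\<^sup>2)
      - ((r - y + a * sqrt (G t))\<^sup>2 / (2 * \<sigma>\<^sup>2) * of_bool (r - y + a * sqrt (G t) \<le> 0)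
        + (r - y - a * sqrt (G t))\<^sup>2 / (2 * \<sigma>\<^sup>2) * of_bool (r - y - a * sqrt (G t) \<ge> 0)) = 0"
      using assms(5) t unfolding is_solution_def cauchy_problem_def G_def by blast
    ultimately show ?thesis by linarith
  qed
  define g where "g t x = f t (r + G t * x)" for t x
  define q where "q t x = excess (a * sqrt (G t)) (G t * x) / (2 * \<sigma>\<^sup>2)" for t x
  have g_x: "((\<lambda>z. g t z) has_real_derivative D_y f t (r + G t * x) * G t) (at x)"
    if "t \<in> {0..<T}" for t x
    unfolding g_def
    by (rule DERIV_chain2[OF C12_has_derivatives(2)[OF C12 that]]) (auto intro!: derivative_eq_intros)
  have src: "has_heat_source (1 / (2 * \<sigma>\<^sup>2)) 0 T UNIV g q"
  proof (rule has_heat_sourceI)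
    fix t x assume t: "t \<in> {0..<T}"
    have "((\<lambda>s. r + G s * x) has_real_derivative - ((G t)\<^sup>2 / \<sigma>\<^sup>2) * x) (at t within {0..<T})"
      using t by (auto intro!: derivative_eq_intros G_deriv)
    then show "((\<lambda>s. g s x) has_real_derivative D_t T f t (r + G t * x)
        + D_y f t (r + G t * x) * (- ((G t)\<^sup>2 / \<sigma>\<^sup>2) * x)) (at t within {0..<T})"
      unfolding g_def by (rule C12_has_derivative_along_curve[OF C12 t])
    show "((\<lambda>z. g t z) has_real_derivative D_y f t (r + G t * x) * G t) (at x)"
      by (rule g_x[OF t])
    have "((\<lambda>z. D_y f t (r + G t * z)) has_real_derivative D_yy f t (r + G t * x) * G t) (at x)"
      by (rule DERIV_chain2[OF C12_has_derivatives(3)[OF C12 t]]) (auto intro!: derivative_eq_intros)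
    from DERIV_cmult_right[OF this, of "G t"]
    show "((\<lambda>z. D_y f t (r + G t * z) * G t) has_real_derivative D_yy f t (r + G t * x) * (G t)\<^sup>2) (at x)"
      by (simp add: power2_eq_square mult.assoc)
    \<comment> \<open>At \<open>y = r + G t * x\<close> the drift coefficient
      \<open>G t * (r - y) / \<sigma>^2\<close> equals \<open>- (G t)^2 x / \<sigma>^2\<close>,
      exactly the term produced by the moving point.\<close>
    show "D_t T f t (r + G t * x) + D_y f t (r + G t * x) * (- ((G t)\<^sup>2 / \<sigma>\<^sup>2) * x)
        + 1 / (2 * \<sigma>\<^sup>2) * (D_yy f t (r + G t * x) * (G t)\<^sup>2) = q t x"
      using pde[OF t, of "r + G t * x"] by (simp add: q_def power2_eq_square algebra_simps)
  qed
  have "\<exists>C. \<forall>y. \<forall>t\<in>{0..T}. \<bar>f t y\<bar> \<le> C * (1 + y\<^sup>2)"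
    using assms(5) unfolding is_solution_def quadratic_growth_def by blast
  then obtain C where C: "\<And>t y. t \<in> {0..T} \<Longrightarrow> \<bar>f t y\<bar> \<le> C * (1 + y\<^sup>2)" by blast
  have C0: "C \<ge> 0" using C[of 0 0] assms(1) by auto
  \<comment> \<open>From \<open>(r + G t * x)^2 \<le> 2 r^2 + 2 (G 0)^2 x^2\<close>, as
    \<open>G\<close> is largest at 0.\<close>
  define C' where "C' = C * (1 + 2 * r\<^sup>2 + 2 * (G 0)\<^sup>2)"
  interpret heat_problem "1 / (2 * \<sigma>\<^sup>2)" T C' g q
  proof
    show "1 / (2 * \<sigma>\<^sup>2) > 0" using assms(2) by simp
    have "continuous_on {0..T} G"
      by (rule DERIV_continuous_on[where D = "\<lambda>t. - ((G t)\<^sup>2 / \<sigma>\<^sup>2)"]) (auto intro: G_deriv)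
    then have "continuous_on ({0..T} \<times> UNIV) (\<lambda>p::real \<times> real. G (fst p))"
      by (rule continuous_on_compose2) (auto intro!: continuous_intros)
    then have "continuous_on ({0..T} \<times> UNIV) (\<lambda>p::real \<times> real. (fst p, r + G (fst p) * snd p))"
      by (intro continuous_intros)
    then have "continuous_on ({0..T} \<times> UNIV)
        (\<lambda>p. (\<lambda>(t, y). f t y) (fst p, r + G (fst p) * snd p))"
      by (rule continuous_on_compose2[OF cont]) auto
    then show "continuous_on ({0..T} \<times> UNIV) (\<lambda>(t, x). g t x)"
      by (simp add: g_def case_prod_unfold)
    show "g T x = 0" for x by (simp add: g_def f_T)
    fix t x assume t: "t \<in> {0..T}"
    have "(r + G t * x)\<^sup>2 + (r - G t * x)\<^sup>2 = 2 * r\<^sup>2 + 2 * ((G t)\<^sup>2 * x\<^sup>2)"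
      by (simp add: power2_eq_square algebra_simps)
    then have "(r + G t * x)\<^sup>2 \<le> 2 * r\<^sup>2 + 2 * ((G t)\<^sup>2 * x\<^sup>2)"
      using zero_le_power2[of "r - G t * x"] by linarith
    moreover have "(G t)\<^sup>2 * x\<^sup>2 \<le> (G 0)\<^sup>2 * x\<^sup>2"
      using G_le[of 0 t] G_pos[of t] t by (intro mult_right_mono power_mono) auto
    moreover have "(1 + 2 * r\<^sup>2 + 2 * (G 0)\<^sup>2) * (1 + x\<^sup>2) =
        1 + 2 * r\<^sup>2 + 2 * (G 0)\<^sup>2 + x\<^sup>2 + 2 * (r\<^sup>2 * x\<^sup>2) + 2 * ((G 0)\<^sup>2 * x\<^sup>2)"
      by (simp add: algebra_simps)
    moreover have "r\<^sup>2 * x\<^sup>2 \<ge> 0" "(G 0)\<^sup>2 \<ge> 0" "x\<^sup>2 \<ge> 0" by simp_all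
    ultimately have "1 + (r + G t * x)\<^sup>2 \<le> (1 + 2 * r\<^sup>2 + 2 * (G 0)\<^sup>2) * (1 + x\<^sup>2)" by linarith
    then have "C * (1 + (r + G t * x)\<^sup>2) \<le> C' * (1 + x\<^sup>2)"
      unfolding C'_def mult.assoc using C0 by (rule mult_left_mono)
    with C[OF t, of "r + G t * x"] show "\<bar>g t x\<bar> \<le> C' * (1 + x\<^sup>2)" by (simp add: g_def)
  qed (rule src)
  \<comment> \<open>A threshold uniform in \<open>t\<close>: for \<open>x > M\<close>, \<open>a sqrt
    (G t) \<le> a sqrt (G 0) = G T * M < G T * x \<le> G t * x\<close>, so the source has left its
    flat part.\<close>
  define M where "M = a * sqrt (G 0) / G T"
  have q_mono: "q t y \<le> q t x" if "t \<in> {0..<T}" "\<bar>y\<bar> \<le> x" for t x y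
  proof -
    have "G t * \<bar>y\<bar> \<le> G t * \<bar>x\<bar>" using G_pos[of t] that by (intro mult_left_mono) auto
    then show ?thesis unfolding q_def using G_pos[of t] that
      by (intro divide_right_mono excess_mono) (auto simp: abs_mult)
  qed
  have q_strict: "q t y < q t x" if t: "t \<in> {0..<T}" and "\<bar>y\<bar> < x" "x > M" for t x y
  proof -
    have "G t * \<bar>y\<bar> < G t * \<bar>x\<bar>" using G_pos[of t] that by (intro mult_strict_left_mono) auto
    moreover have "a * sqrt (G t) < \<bar>G t * x\<bar>"
    proof -
      have "a * sqrt (G t) \<le> a * sqrt (G 0)"
        using G_le[of 0 t] t assms(4) by (intro mult_left_mono) auto
      also have "\<dots> = G T * M" using G_pos[of T] assms(1) by (simp add: M_def)
      also have "\<dots> < G T * x" using G_pos[of T] assms(1) that by (intro mult_strict_left_mono) auto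
      also have "\<dots> \<le> G t * x" using G_le[of t T] that by (intro mult_right_mono) auto
      finally show ?thesis by simp
    qed
    ultimately show ?thesis unfolding q_def using G_pos[of t] t assms(2)
      by (intro divide_strict_right_mono excess_strict_mono) (auto simp: abs_mult)
  qed
  have M_nonneg: "M \<ge> 0" using assms G_pos[of 0] G_pos[of T] by (simp add: M_def)
  have q_nonneg: "q t x \<ge> 0" for t x by (simp add: q_def excess_nonneg)
  have g_neg: "g t x < 0" if "t \<in> {0..<T}" for t x
  proof (rule negative[OF q_nonneg _ that])
    fix t x assume "t \<in> {0..<T}" "x > M"
    then show "q t x > 0" using q_strict[of t 0 x] q_nonneg[of t 0] M_nonneg by auto
  qed
  have g_even: "g t (- x) = g t x" if "t \<in> {0..T}" for t x
    by (rule even_in_space[OF _ that]) (simp add: q_def excess_uminus)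
  have g_decr: "g t x < g t y" if "t \<in> {0..<T}" "\<bar>y\<bar> < x" for t x y
    by (rule strictly_decreasing_in_abs[OF q_mono q_strict that])
  have q_convex: "q t (x + k) + q t (x + l) \<le> q t (x + k + l) + q t x"
    if "t \<in> {0..<T}" "k \<ge> 0" "l \<ge> 0" for t x k l
    using convex_on_second_difference[OF convex_excess, of "G t * k" "G t * l" "a * sqrt (G t)" "G t * x"]
      that G_pos[of t] assms(2)
    by (simp add: q_def distrib_left divide_right_mono flip: add_divide_distrib)
  have rescale: "r + G t * ((y - r) / G t) = y" if "t \<in> {0..<T}" for t y
    using G_pos[of t] that by simp
  have neg: "f t y < 0" if "t \<in> {0..<T}" for t y
    using g_neg[OF that, of "(y - r) / G t"] rescale[OF that] by (simp add: g_def)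
  have dec: "D_y f t y \<le> D_y f t x" if t: "t \<in> {0..<T}" and "x \<le> y" for t x y
  proof -
    have G: "G t > 0" using G_pos t by simp
    have "D_y f t (r + G t * ((y - r) / G t)) * G t \<le> D_y f t (r + G t * ((x - r) / G t)) * G t"
      by (rule derivative_antimono[OF q_convex _ _ g_x[OF t] g_x[OF t]])
         (use t that G in \<open>auto intro: divide_right_mono\<close>)
    then show ?thesis using G unfolding rescale[OF t] by simp
  qed
  have f_sym: "f t (2 * r - y) = f t y" if t: "t \<in> {0..<T}" for t y
  proof -
    have "r + G t * - ((y - r) / G t) = 2 * r - y" using G_pos[of t] t by simp
    moreover have "f t (r + G t * - ((y - r) / G t)) = f t (r + G t * ((y - r) / G t))"
      using g_even[of t "(y - r) / G t"] t unfolding g_def by simp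
    ultimately show ?thesis using rescale[OF t, of y] by metis
  qed
  \<comment> \<open>The symmetry of \<open>f\<close> about \<open>r\<close> makes \<open>D_y\<close>
    odd about \<open>r\<close>. This gives the value 0 at \<open>r\<close> and transfers the sign
    from \<open>y > r\<close> to \<open>y < r\<close>.\<close>
  have D_sym: "D_y f t (2 * r - y) = - D_y f t y" if t: "t \<in> {0..<T}" for t y
  proof -
    have "((\<lambda>x. f t (2 * r - x)) has_real_derivative D_y f t (2 * r - y) * (0 - 1)) (at y)"
      by (rule DERIV_chain2[OF C12_has_derivatives(2)[OF C12 t]]) (auto intro!: derivative_eq_intros)
    then have "((\<lambda>x. f t x) has_real_derivative - D_y f t (2 * r - y)) (at y)"
      by (simp add: f_sym[OF t])
    from DERIV_unique[OF this C12_has_derivatives(2)[OF C12 t]] show ?thesis by simp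
  qed
  have D_r: "D_y f t r = 0" if "t \<in> {0..<T}" for t
    using D_sym[OF that, of r] by simp
  \<comment> \<open>At the final time the derivative is read off from the zero function, as
    \<open>C12\<close> speaks only of times before \<open>T\<close>.\<close>
  have "f T = (\<lambda>y. 0)" using f_T by blast
  then have D_T: "D_y f T y = 0" for y by (simp add: D_y_def)
  \<comment> \<open>Strict decrease of \<open>f\<close> gives a negative derivative at some
    \<open>z\<close> between \<open>r\<close> and \<open>y\<close>, and monotonicity of
    \<open>D_y\<close> carries the strict sign on to \<open>y\<close>.\<close>
  have D_neg: "D_y f t y < 0" if t: "t \<in> {0..<T}" and y: "y > r" for t y
  proof -
    have G: "G t > 0" using G_pos t by simp
    have "f t y < f t r"
      using g_decr[OF t, of 0 "(y - r) / G t"] y G rescale[OF t, of y] by (simp add: g_def)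
    moreover obtain z where z: "z > r" "z < y" "f t y - f t r = (y - r) * D_y f t z"
      using MVT2[OF y, of "f t" "D_y f t"] C12_has_derivatives(2)[OF C12 t] by blast
    ultimately have "D_y f t z < 0" using y by (smt (verit) mult_nonneg_nonneg)
    then show ?thesis using dec[OF t, of z y] z by simp
  qed
  have D_pos: "D_y f t y > 0" if t: "t \<in> {0..<T}" and "y < r" for t y
    using D_neg[OF t, of "2 * r - y"] D_sym[OF t, of y] that by simp
  have "D_y f t r = 0" if "t \<in> {0..T}" for t
    using D_r[of t] D_T[of r] that by (cases "t = T") auto
  then show ?thesis using neg dec D_pos D_neg D_T by (auto intro!: antimonoI)
qed

end
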